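(* Let $P\subseteq\mathbb{R}^n$ be an $n$-dimensional lattice polytope with $\mathrm{cd}(P)>\lceil\frac{n+1}{2}\rceil$. Then through every vertex of $P$ there is an edge of $P$ whose only lattice points are its two vertices.
   Context: The codegree of $P$ is $\mathrm{cd}(P):=\min\{k\in\mathbb{Z}_{\ge1}:\mathrm{int}(kP)\cap\mathbb{Z}^n\neq\emptyset\}$. *)

theory Defs
  imports "HOL-Analysis.Analysis"
begin

definition lattice_point :: "real ^ 'n \<Rightarrow> bool" where
  "lattice_point x \<longleftrightarrow> (\<forall>i. x $ i \<in> \<int>)"

definition lattice_polytope :: "(real ^ 'n) set \<Rightarrow> bool" where
  "lattice_polytope P \<longleftrightarrow>
     (\<exists>S. finite S \<and> S \<noteq> {} \<and> (\<forall>x\<in>S. lattice_point x) \<and> P = convex hull S)"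

text \<open>Codegree: least k \<ge> 1 such that the interior of kP contains a lattice point.\<close>
definition codegree :: "(real ^ 'n) set \<Rightarrow> nat" where
  "codegree P = (LEAST k::nat. k \<ge> 1 \<and>
                    (\<exists>x. x \<in> interior ((*\<^sub>R) (real k) ` P) \<and> lattice_point x))"

end

theory Submission
  imports Defs
begin

text \<open>Suppose every edge of \<open>P\<close> at the vertex \<open>v\<close> contains a further lattice point. Then each
  such edge is spanned by a lattice vector \<open>a\<close> with \<open>v + 2a \<in> P\<close>, and since the edges at a vertex
  span the affine hull of a full-dimensional polytope, there is a basis \<open>b\<^sub>1, \<dots>, b\<^sub>n\<close> of such
  vectors. For \<open>k = \<lceil>(n + 1) / 2\<rceil>\<close> the simplex with vertices \<open>kv\<close> and \<open>k(v + 2b\<^sub>i)\<close> lies in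
  \<open>kP\<close>, and because \<open>2k > n\<close> it contains the lattice point \<open>kv + b\<^sub>1 + \<dots> + b\<^sub>n\<close> in its interior
  (barycentric coordinates \<open>1/(2k)\<close> and \<open>1 - n/(2k)\<close>). Hence \<open>cd(P) \<le> k\<close>.\<close>

lemma edge_of_polytope_obtains_segment:
  fixes E :: "'a::euclidean_space set"
  assumes "polytope P" "E edge_of P"
  obtains a b where "a \<noteq> b" "E = closed_segment a b"
proof -
  have pE: "polytope E" using assms face_of_polytope_polytope edge_of_def by blast
  have dim: "aff_dim E = 1" using assms(2) edge_of_def by blast
  then have "E \<noteq> {}" "collinear E" by (auto simp: collinear_aff_dim)
  then obtain a b where ab: "E = closed_segment a b"
    using compact_convex_collinear_segment polytope_imp_compact polytope_imp_convex pE by metis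
  then have "a \<noteq> b" using dim by auto
  then show ?thesis using ab that by blast
qed

lemma polytope_edge_at_vertex_eq_segment:
  fixes E :: "'a::euclidean_space set"
  assumes "polytope P" "E edge_of P" "v extreme_point_of P" "v \<in> E"
  obtains w where "w \<noteq> v" "E = closed_segment v w" "w extreme_point_of P"
proof -
  obtain a b where ab: "a \<noteq> b" "E = closed_segment a b"
    using edge_of_polytope_obtains_segment assms(1,2) by blast
  have face: "E face_of P" using assms(2) edge_of_def by blast
  then have "v extreme_point_of E" using extreme_point_of_face assms(3,4) by blast
  then have "v = a \<or> v = b" using ab extreme_point_of_segment by blast
  then obtain w where w: "w \<noteq> v" "E = closed_segment v w"
    using ab closed_segment_commute by metis
  then have "w extreme_point_of E" using extreme_point_of_segment by blast
  then have "w extreme_point_of P" using face extreme_point_of_face by blast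
  with w show ?thesis using that by blast
qed

lemma affine_hull_facet_Un_eq:
  fixes F :: "'a::euclidean_space set"
  assumes "G facet_of F" "H \<subseteq> F" "\<not> H \<subseteq> affine hull G"
  shows "affine hull (G \<union> H) = affine hull F"
proof -
  have "affine hull G \<subset> affine hull (G \<union> H)"
    using assms(3) by (metis Un_upper1 Un_upper2 hull_mono hull_subset psubsetI subset_trans)
  then have "aff_dim G < aff_dim (G \<union> H)" by (rule aff_dim_psubset)
  moreover have "aff_dim G = aff_dim F - 1" using assms(1) facet_of_def by blast
  moreover have GH: "G \<union> H \<subseteq> F" using assms(1,2) facet_of_imp_subset by blast
  moreover have "aff_dim (G \<union> H) \<le> aff_dim F" using GH aff_dim_subset by blast
  ultimately have "aff_dim (G \<union> H) = aff_dim F" by linarith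
  then show ?thesis using aff_dim_eq_full_gen GH by blast
qed

text \<open>A vertex is the intersection of the facets through it; if these all lay in the affine hull
  of one facet \<open>G\<close>, they would all equal \<open>G\<close>, forcing \<open>G = {v}\<close>.\<close>
lemma polytope_vertex_two_facets:
  fixes F :: "'a::euclidean_space set"
  assumes "polytope F" "v extreme_point_of F" "aff_dim F \<ge> 2"
  obtains G H where "G facet_of F" "H facet_of F" "v \<in> G" "v \<in> H" "\<not> H \<subseteq> affine hull G"
proof -
  have "F \<noteq> {v}" using assms(3) by auto
  moreover have "{v} face_of F" using assms(2) face_of_singleton by blast
  ultimately have vertex: "{v} = \<Inter>{G. G facet_of F \<and> {v} \<subseteq> G}"
    using face_of_polyhedron[OF polytope_imp_polyhedron[OF assms(1)]] by blast
  have "{G. G facet_of F \<and> {v} \<subseteq> G} \<noteq> {}"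
  proof
    assume "{G. G facet_of F \<and> {v} \<subseteq> G} = {}"
    then have "{v} = UNIV" using vertex by (metis Inter_empty)
    then show False using \<open>F \<noteq> {v}\<close> assms(2) extreme_point_of_def by blast
  qed
  then obtain G where G: "G facet_of F" "v \<in> G" by blast
  have "\<exists>H. H facet_of F \<and> v \<in> H \<and> \<not> H \<subseteq> affine hull G"
  proof (rule ccontr)
    assume none: "\<not> ?thesis"
    have "G \<subseteq> H" if H: "H facet_of F" "v \<in> H" for H
    proof -
      have "G = affine hull G \<inter> F"
        using face_of_imp_eq_affine_Int[OF polytope_imp_convex[OF assms(1)]]
          facet_of_imp_face_of[OF G(1)] by blast
      moreover have "H \<subseteq> affine hull G" using H none by blast
      ultimately have "H \<subseteq> G" using facet_of_imp_subset[OF H(1)] by blast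
      then have "H face_of G"
        using face_of_subset facet_of_imp_face_of[OF H(1)] facet_of_imp_subset[OF G(1)] by blast
      moreover have "aff_dim H = aff_dim G" using H(1) G(1) unfolding facet_of_def by simp
      moreover have "convex G" using G(1) facet_of_imp_face_of face_of_imp_convex by blast
      ultimately show ?thesis using face_of_aff_dim_lt by fastforce
    qed
    then have "G = {v}" using vertex G(2) by blast
    then show False using G(1) assms(3) unfolding facet_of_def by simp
  qed
  then show ?thesis using that G by blast
qed

lemma polytope_subset_affine_hull_edges_at_vertex:
  fixes F :: "'a::euclidean_space set"
  assumes "polytope F" "v extreme_point_of F"
  shows "F \<subseteq> affine hull (insert v (\<Union>{E. E edge_of F \<and> v \<in> E}))"
  using assms
proof (induction "nat (aff_dim F)" arbitrary: F rule: less_induct)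
  case less
  define A where "A = affine hull (insert v (\<Union>{E. E edge_of F \<and> v \<in> E}))"
  have vF: "v \<in> F" using less.prems(2) extreme_point_of_def by blast
  then have "\<not> aff_dim F < 0" by auto
  then consider "aff_dim F = 0" | "aff_dim F = 1" | "aff_dim F \<ge> 2" by linarith
  then show ?case
  proof cases
    case 1
    then have "F = {v}" using vF aff_dim_eq_0 by (metis singletonD)
    then show ?thesis by (simp add: hull_inc)
  next
    case 2
    then have "F edge_of F"
      unfolding edge_of_def using face_of_refl polytope_imp_convex less.prems(1) by blast
    then have "F \<subseteq> insert v (\<Union>{E. E edge_of F \<and> v \<in> E})" using vF by blast
    then show ?thesis using hull_subset by (rule order_trans)
  next
    case 3
    have facet_subset: "G \<subseteq> A" if "G facet_of F" "v \<in> G" for G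
    proof -
      have face: "G face_of F" using that facet_of_imp_face_of by blast
      have "G \<subseteq> affine hull (insert v (\<Union>{E. E edge_of G \<and> v \<in> E}))"
      proof (rule less.hyps)
        have "aff_dim G = aff_dim F - 1" using that(1) facet_of_def by blast
        then show "nat (aff_dim G) < nat (aff_dim F)" using 3 by linarith
        show "polytope G" using face_of_polytope_polytope less.prems(1) face by blast
        show "v extreme_point_of G" using extreme_point_of_face face that(2) less.prems(2) by blast
      qed
      also have "\<dots> \<subseteq> A"
      proof -
        have "E edge_of F" if "E edge_of G" for E
          using that face_of_trans[OF _ face] unfolding edge_of_def by blast
        then show ?thesis unfolding A_def by (intro hull_mono) blast
      qed
      finally show ?thesis .
    qed
    obtain G H where GH: "G facet_of F" "H facet_of F" "v \<in> G" "v \<in> H" "\<not> H \<subseteq> affine hull G"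
      using polytope_vertex_two_facets[OF less.prems 3] by blast
    have "affine hull F = affine hull (G \<union> H)"
      using affine_hull_facet_Un_eq[OF GH(1) facet_of_imp_subset[OF GH(2)] GH(5)] by simp
    also have "\<dots> \<subseteq> A"
      using facet_subset GH by (intro hull_minimal) (auto simp: A_def)
    finally show ?thesis unfolding A_def by (rule order_trans[OF hull_subset])
  qed
qed

lemma sum_in_interior_simplex:
  fixes B :: "'a::euclidean_space set"
  assumes B: "independent B" "card B = DIM('a)" and c: "real DIM('a) < c"
  shows "x + (\<Sum>b\<in>B. b) \<in> interior (convex hull (insert x ((\<lambda>b. x + c *\<^sub>R b) ` B)))"
proof -
  define S where "S = insert 0 ((*\<^sub>R) c ` B)"
  have c0: "c > 0" using c by (metis of_nat_0_le_iff le_less_trans)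
  have finB: "finite B" using B(1) independent_imp_finite by blast
  have inj: "inj_on ((*\<^sub>R) c) B" using c0 by (auto simp: inj_on_def)
  have notin: "0 \<notin> (*\<^sub>R) c ` B" using B(1) c0 dependent_zero by force
  have "independent ((*\<^sub>R) c ` B)"
    using B(1) c0
    by (intro linear_independent_injective_image) (auto intro: linear_compose_scale_right simp: inj_on_def)
  then have "\<not> affine_dependent S"
    unfolding S_def affine_dependent_iff_dependent[OF notin] by simp
  moreover have cardS: "card S = DIM('a) + 1"
    unfolding S_def using finB notin card_image[OF inj] B(2) by simp
  define u where "u y = (if y = 0 then 1 - real DIM('a) / c else 1 / c)" for y :: 'a
  have u_scaled: "u (c *\<^sub>R b) = 1 / c" if "b \<in> B" for b
    using that notin by (auto simp: u_def)
  have "\<forall>y\<in>S. 0 < u y" using c c0 by (simp add: u_def)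
  moreover have "sum u S = 1"
    using finB notin c0 B(2) by (simp add: S_def sum.reindex[OF inj] u_scaled) (simp add: u_def)
  moreover have "(\<Sum>y\<in>S. u y *\<^sub>R y) = (\<Sum>b\<in>B. b)"
    using finB notin c0 by (simp add: S_def sum.reindex[OF inj] u_scaled)
  ultimately have "(\<Sum>b\<in>B. b) \<in> interior (convex hull S)"
    by (subst interior_convex_hull_explicit_minimal) (auto simp: cardS)
  moreover have "insert x ((\<lambda>b. x + c *\<^sub>R b) ` B) = (+) x ` S"
    by (auto simp: S_def image_image)
  ultimately show ?thesis
    by (simp add: convex_hull_translation interior_translation)
qed

lemma lattice_point_diff: "lattice_point x \<Longrightarrow> lattice_point y \<Longrightarrow> lattice_point (x - y)"
  unfolding lattice_point_def by auto

lemma lattice_polytope_imp_polytope: "lattice_polytope P \<Longrightarrow> polytope P"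
  unfolding lattice_polytope_def by (auto intro: polytope_convex_hull)

lemma lattice_polytope_extreme_point_lattice_point:
  assumes "lattice_polytope P" "x extreme_point_of P"
  shows "lattice_point x"
  using assms extreme_point_of_convex_hull unfolding lattice_polytope_def by metis

text \<open>Of the two lattice vectors from the interior lattice point to the endpoints, the shorter one
  has at most half the length of the segment.\<close>
lemma lattice_direction_of_segment:
  fixes v w :: "real ^ 'n"
  assumes "x \<in> closed_segment v w" "x \<noteq> v" "x \<noteq> w"
    and "lattice_point x" "lattice_point v" "lattice_point w"
  obtains a where "lattice_point a" "v + 2 *\<^sub>R a \<in> closed_segment v w"
    "closed_segment v w \<subseteq> range (\<lambda>t. v + t *\<^sub>R a)"
proof -
  obtain s where s: "0 \<le> s" "s \<le> 1" "x = (1 - s) *\<^sub>R v + s *\<^sub>R w"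
    using assms(1) unfolding closed_segment_def by blast
  have "s \<noteq> 0" "s \<noteq> 1" using s assms(2,3) by auto
  have xv: "x - v = s *\<^sub>R (w - v)" and wx: "w - x = (1 - s) *\<^sub>R (w - v)"
    using s by (simp_all add: algebra_simps)
  have lx: "lattice_point (x - v)" "lattice_point (w - x)"
    using lattice_point_diff assms(4-6) by blast+
  obtain c a where ca: "0 < c" "c \<le> 1/2" "a = c *\<^sub>R (w - v)" "lattice_point a"
  proof (cases "s \<le> 1/2")
    case True
    then show ?thesis using that[of s "x - v"] s \<open>s \<noteq> 0\<close> xv lx by simp
  next
    case False
    then show ?thesis using that[of "1 - s" "w - x"] s \<open>s \<noteq> 1\<close> wx lx by simp
  qed
  have "v + 2 *\<^sub>R a = (1 - 2 * c) *\<^sub>R v + (2 * c) *\<^sub>R w"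
    unfolding ca(3) by (simp add: algebra_simps)
  then have "v + 2 *\<^sub>R a \<in> closed_segment v w"
    unfolding closed_segment_def using ca(1,2) by auto
  moreover have "closed_segment v w \<subseteq> range (\<lambda>t. v + t *\<^sub>R a)"
  proof
    fix y assume "y \<in> closed_segment v w"
    then obtain t where "y = (1 - t) *\<^sub>R v + t *\<^sub>R w" unfolding closed_segment_def by blast
    then have "y = v + t *\<^sub>R (w - v)" by (simp add: algebra_simps)
    also have "t *\<^sub>R (w - v) = (t / c) *\<^sub>R a" using ca(1,3) by simp
    finally have "y = v + (t / c) *\<^sub>R a" .
    then show "y \<in> range (\<lambda>t. v + t *\<^sub>R a)" by blast
  qed
  ultimately show ?thesis using that ca(4) by blast
qed

lemma lattice_direction_of_edge:
  fixes P :: "(real ^ 'n) set"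
  assumes P: "lattice_polytope P" and E: "E edge_of P" "v \<in> E" and v: "v extreme_point_of P"
    and extra: "{x \<in> E. lattice_point x} \<noteq> {x. x extreme_point_of E}"
  obtains a where "lattice_point a" "v + 2 *\<^sub>R a \<in> P" "E \<subseteq> range (\<lambda>t. v + t *\<^sub>R a)"
proof -
  obtain w where w: "w \<noteq> v" "E = closed_segment v w" "w extreme_point_of P"
    using polytope_edge_at_vertex_eq_segment[OF lattice_polytope_imp_polytope[OF P] E(1) v E(2)] .
  have "lattice_point v" "lattice_point w"
    using lattice_polytope_extreme_point_lattice_point P v w(3) by blast+
  moreover have "{x. x extreme_point_of E} = {v, w}" using w(2) extreme_point_of_segment by blast
  ultimately have "{v, w} \<subset> {x \<in> E. lattice_point x}" using extra w(2) by auto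
  then obtain x where "x \<in> E" "lattice_point x" "x \<noteq> v" "x \<noteq> w" by blast
  then obtain a where "lattice_point a" "v + 2 *\<^sub>R a \<in> E" "E \<subseteq> range (\<lambda>t. v + t *\<^sub>R a)"
    using lattice_direction_of_segment \<open>lattice_point v\<close> \<open>lattice_point w\<close> w(2) by metis
  then show ?thesis using that edge_of_imp_subset[OF E(1)] by blast
qed

lemma span_eq_UNIV_if_vertex_edges_in_lines:
  fixes P :: "'a::euclidean_space set"
  assumes "polytope P" "aff_dim P = DIM('a)" "v extreme_point_of P"
    and edges: "\<And>E. E edge_of P \<Longrightarrow> v \<in> E \<Longrightarrow> \<exists>a\<in>A. E \<subseteq> range (\<lambda>t. v + t *\<^sub>R a)"
  shows "span A = UNIV"
proof -
  define L where "L = (+) v ` span A"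
  have "affine L" unfolding L_def
    using affine_translation subspace_imp_affine subspace_span by blast
  have "v \<in> L" unfolding L_def using span_zero by force
  moreover have "E \<subseteq> L" if edge: "E edge_of P" "v \<in> E" for E
  proof -
    obtain a where "a \<in> A" "E \<subseteq> range (\<lambda>t. v + t *\<^sub>R a)" using edges[OF edge] by blast
    moreover have "range (\<lambda>t. v + t *\<^sub>R a) \<subseteq> L"
      unfolding L_def using span_mul[OF span_base[OF \<open>a \<in> A\<close>]] by blast
    ultimately show ?thesis by blast
  qed
  ultimately have "affine hull (insert v (\<Union>{E. E edge_of P \<and> v \<in> E})) \<subseteq> L"
    using \<open>affine L\<close> by (intro hull_minimal) auto
  then have "P \<subseteq> L"
    using polytope_subset_affine_hull_edges_at_vertex[OF assms(1,3)] by blast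
  then have "affine hull P \<subseteq> L" using \<open>affine L\<close> hull_minimal by blast
  moreover have "affine hull P = UNIV" using assms(2) aff_dim_eq_full by blast
  ultimately have "L = UNIV" by blast
  have "z \<in> span A" for z
  proof -
    have "v + z \<in> L" using \<open>L = UNIV\<close> by blast
    then obtain y where "y \<in> span A" "v + z = v + y" unfolding L_def by blast
    then show ?thesis by simp
  qed
  then show ?thesis by blast
qed

lemma codegree_le_if_lattice_basis_at_vertex:
  fixes P :: "(real ^ 'n) set"
  assumes P: "convex P" "v \<in> P" "lattice_point v"
    and B: "B \<subseteq> {a. lattice_point a \<and> v + 2 *\<^sub>R a \<in> P}" "independent B" "card B = CARD('n)"
    and k: "k \<ge> 1" "real CARD('n) < 2 * real k"
  shows "codegree P \<le> k"
proof -
  define p where "p = real k *\<^sub>R v + (\<Sum>b\<in>B. b)"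
  let ?S = "insert (real k *\<^sub>R v) ((\<lambda>b. real k *\<^sub>R v + (2 * real k) *\<^sub>R b) ` B)"
  have "p \<in> interior (convex hull ?S)"
    unfolding p_def using sum_in_interior_simplex[OF B(2)] B(3) k(2) by simp
  moreover have "convex hull ?S \<subseteq> (*\<^sub>R) (real k) ` P"
  proof (rule hull_minimal)
    have "real k *\<^sub>R v + (2 * real k) *\<^sub>R b = real k *\<^sub>R (v + 2 *\<^sub>R b)" for b
      by (simp add: algebra_simps)
    then show "?S \<subseteq> (*\<^sub>R) (real k) ` P" using P(2) B(1) by auto
    show "convex ((*\<^sub>R) (real k) ` P)" using convex_scaling[OF P(1)] by simp
  qed
  ultimately have "p \<in> interior ((*\<^sub>R) (real k) ` P)" using interior_mono by blast
  moreover have "lattice_point p"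
    using P(3) B(1) unfolding p_def lattice_point_def by (auto intro!: Ints_add Ints_mult Ints_sum)
  ultimately show ?thesis unfolding codegree_def using k(1) by (intro Least_le) blast
qed

theorem lemma3p3:
  fixes P :: "(real ^ 'n) set"
  assumes "lattice_polytope P"
    and "aff_dim P = int CARD('n)"
    and "int (codegree P) > \<lceil>real (CARD('n) + 1) / 2\<rceil>"
    and "v extreme_point_of P"
  shows "\<exists>E. E edge_of P \<and> v \<in> E \<and>
             {x \<in> E. lattice_point x} = {x. x extreme_point_of E}"
proof (rule ccontr)
  assume no_primitive_edge: "\<not> ?thesis"
  have "polytope P" using lattice_polytope_imp_polytope[OF assms(1)] .
  define A where "A = {a. lattice_point a \<and> v + 2 *\<^sub>R a \<in> P}"
  have "span A = UNIV"
  proof (rule span_eq_UNIV_if_vertex_edges_in_lines[OF \<open>polytope P\<close> _ assms(4)])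
    show "aff_dim P = DIM(real ^ 'n)" using assms(2) by simp
    fix E assume E: "E edge_of P" "v \<in> E"
    then obtain a where "lattice_point a" "v + 2 *\<^sub>R a \<in> P" "E \<subseteq> range (\<lambda>t. v + t *\<^sub>R a)"
      using lattice_direction_of_edge[OF assms(1) E assms(4)] no_primitive_edge by blast
    then show "\<exists>a\<in>A. E \<subseteq> range (\<lambda>t. v + t *\<^sub>R a)" unfolding A_def by blast
  qed
  moreover have "dim A = CARD('n)" using \<open>span A = UNIV\<close> dim_span[of A] by simp
  ultimately obtain B where B: "B \<subseteq> A" "independent B" "card B = CARD('n)"
    using basis_exists[of A] by metis
  define k where "k = nat \<lceil>real (CARD('n) + 1) / 2\<rceil>"
  have "real (CARD('n) + 1) / 2 \<le> real k" unfolding k_def by (rule real_nat_ceiling_ge)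
  then have k: "k \<ge> 1" "real CARD('n) < 2 * real k" by auto
  have "codegree P \<le> k"
  proof (rule codegree_le_if_lattice_basis_at_vertex[OF _ _ _ B[unfolded A_def] k])
    show "convex P" using polytope_imp_convex[OF \<open>polytope P\<close>] .
    show "v \<in> P" using assms(4) extreme_point_of_def by blast
    show "lattice_point v" using lattice_polytope_extreme_point_lattice_point[OF assms(1,4)] .
  qed
  then show False using assms(3) unfolding k_def by linarith
qed

end
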